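(* Let $G_1,G_2$ and $H$ be graphs. If $G_1\cap G_2$ is an induced subgraph of both $G_1$ and $G_2$, then $$ I_{G_1\to H}\times_{G_1\cap G_2\to H} I_{G_2\to H}=I_{G_1\cup G_2\to H}. $$
   Context: Graphs are finite and undirected without multiple edges; loops are allowed. $G_1\cap G_2$ and $G_1\cup G_2$ are the graphs obtained by intersecting, respectively taking unions of, vertex sets and edge sets. $\mathrm{Hom}(G,H)$ is the set of maps $\phi:V(G)\to V(H)$ with $\phi(u)\phi(v)\in E(H)$ whenever $uv\in E(G)$. Fix a field $\mathbf{k}$. For $e\in E(G)$ let $G[e]$ be the subgraph consisting only of $e$ and its endpoint(s). Put $R_{G\to H}=\mathbf{k}[r_\phi : \phi\in\mathrm{Hom}(G,H)]$, $S_{G\to H}=\mathbf{k}[s_\psi : e\in E(G),\ \psi\in \mathrm{Hom}(G[e],H)]$, let $\Phi_{G\to H}$ be the $\mathbf{k}$-algebra map with $\Phi(r_\phi)=\prod_{e\in E(G)} s_{\phi|_e}$, and $I_{G\to H}=\ker\Phi_{G\to H}$. The vector configuration defining $I_{G\to H}$ is the family, indexed by $\phi\in\mathrm{Hom}(G,H)$, of exponent vectors of the monomials $\Phi(r_\phi)$. The toric ideal of a family of vectors $(\mathbf{v}_t)_t$ in $\mathbb{Z}^d_{\ge0}$ is the ideal, in a polynomial ring with one variable per index $t$, generated by the binomials $x^{\mathbf u}-x^{\mathbf w}$ with $\sum_t u_t\mathbf{v}_t=\sum_t w_t\mathbf{v}_t$. Toric fiber product: let $B=(\mathbf{b}^i_j)_{i,\,j\in[s_i]}\subset\mathbb{Z}^{d_1}_{\ge0}$,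 $C=(\mathbf{c}^i_k)_{i,\,k\in[t_i]}\subset\mathbb{Z}^{d_2}_{\ge0}$ and $A=(\mathbf{a}^i)_{i}\subset\mathbb{Z}^e_{\ge0}$ be finite families ($i$ runs over the same finite index set), such that there are linear maps $\pi_1:\mathbb{Z}^{d_1}\to\mathbb{Z}^e$, $\pi_2:\mathbb{Z}^{d_2}\to\mathbb{Z}^e$ with $\pi_1(\mathbf{b}^i_j)=\mathbf{a}^i=\pi_2(\mathbf{c}^i_k)$. Then $I_B\times_A I_C$ is the toric ideal of the family $((\mathbf{b}^i_j,\mathbf{c}^i_k))_{i,j,k}$ in $\mathbb{Z}^{d_1+d_2}$, in the polynomial ring with one variable $z^i_{jk}$ for each triple $(i,j,k)$. The notation $\times_{G_1\cap G_2\to H}$ means: $A$, $B$, $C$ are the configurations defining $I_{G_1\cap G_2\to H}$, $I_{G_1\to H}$, $I_{G_2\to H}$; the index $i$ runs over $\mathrm{Hom}(G_1\cap G_2,H)$, and the vectors of $B$ and $C$ with upper index $i$ are those of the homomorphisms $\phi$ whose restriction to $G_1\cap G_2$ is $i$ (possibly none). A variable indexed by a pair $(\phi_1,\phi_2)$ with $\phi_1|_{G_1\cap G_2}=\phi_2|_{G_1\cap G_2}$ is identified with $r_\phi\in R_{G_1\cup G_2\to H}$, where $\phi|_{G_1}=\phi_1$ and $\phi|_{G_2}=\phi_2$. *)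

theory Defs
  imports
    Complex_Main
    "HOL-Library.Poly_Mapping"
    "HOL-Library.FuncSet"
    "HOL-Algebra.RingHom"
begin

section \<open>Polynomial rings\<close>

text \<open>
  The type \<open>('x \<Rightarrow>\<^sub>0 nat) \<Rightarrow>\<^sub>0 'k\<close> is the ring of polynomials with
  variables indexed by all of \<open>'x\<close>; \<open>Poly_Mapping.single m c\<close> is the term \<open>c x\<^sup>m\<close>.
  Rings whose variables are indexed by a set \<open>X\<close> are the corresponding subrings.
\<close>

type_synonym ('x, 'k) mpoly = "('x \<Rightarrow>\<^sub>0 nat) \<Rightarrow>\<^sub>0 'k"

definition mpoly_ring :: "'x set \<Rightarrow> ('x, 'k::field) mpoly ring" where
  "mpoly_ring X =
    \<lparr>carrier = {p. \<forall>m \<in> Poly_Mapping.keys p. Poly_Mapping.keys m \<subseteq> X},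
     monoid.mult = (*), one = 1, zero = 0, add = (+)\<rparr>"

definition mpoly_var :: "'x \<Rightarrow> ('x, 'k::field) mpoly" where
  "mpoly_var x = Poly_Mapping.single (Poly_Mapping.single x 1) 1"

definition mpoly_subst ::
  "('x \<Rightarrow> ('y, 'k::field) mpoly) \<Rightarrow> ('x, 'k) mpoly \<Rightarrow> ('y, 'k) mpoly" where
  "mpoly_subst f p =
    (\<Sum>m \<in> Poly_Mapping.keys p. Poly_Mapping.single 0 (Poly_Mapping.lookup p m)
        * (\<Prod>x \<in> Poly_Mapping.keys m. f x ^ Poly_Mapping.lookup m x))"

definition mpoly_rename :: "('x \<Rightarrow> 'y) \<Rightarrow> ('x, 'k::field) mpoly \<Rightarrow> ('y, 'k) mpoly" where
  "mpoly_rename g = mpoly_subst (\<lambda>x. mpoly_var (g x))"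

lemma mpoly_ring_simps [simp]:
  "carrier (mpoly_ring X) = {p. \<forall>m \<in> Poly_Mapping.keys p. Poly_Mapping.keys m \<subseteq> X}"
  "x \<otimes>\<^bsub>mpoly_ring X\<^esub> y = x * y" "\<one>\<^bsub>mpoly_ring X\<^esub> = 1"
  "\<zero>\<^bsub>mpoly_ring X\<^esub> = 0" "x \<oplus>\<^bsub>mpoly_ring X\<^esub> y = x + y"
  by (simp_all add: mpoly_ring_def)

lemma keys_add_nat: "Poly_Mapping.keys (m + n) = Poly_Mapping.keys m \<union> Poly_Mapping.keys n"
  for m n :: "'x \<Rightarrow>\<^sub>0 nat"
  by (auto simp: in_keys_iff lookup_add simp del: lookup_not_eq_zero_eq_in_keys)

lemma mpoly_carrier_add:
  "p \<in> carrier (mpoly_ring X) \<Longrightarrow> q \<in> carrier (mpoly_ring X) \<Longrightarrow> p + q \<in> carrier (mpoly_ring X)"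
  using keys_add[of p q] by auto

lemma mpoly_carrier_mult:
  assumes "p \<in> carrier (mpoly_ring X)" "q \<in> carrier (mpoly_ring X)"
  shows "p * q \<in> carrier (mpoly_ring X)"
proof -
  have "Poly_Mapping.keys m \<subseteq> X" if "m \<in> Poly_Mapping.keys (p * q)" for m
  proof -
    have "m \<in> {a + b |a b. a \<in> Poly_Mapping.keys p \<and> b \<in> Poly_Mapping.keys q}"
      using keys_mult[of p q] that by (rule subsetD)
    then obtain a b where "m = a + b" "a \<in> Poly_Mapping.keys p" "b \<in> Poly_Mapping.keys q"
      by blast
    then show ?thesis
      using assms by (auto simp: keys_add_nat)
  qed
  then show ?thesis by simp
qed

lemma cring_mpoly_ring: "cring (mpoly_ring X :: ('x, 'k::field) mpoly ring)"
proof (rule cringI)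
  show "abelian_group (mpoly_ring X :: ('x, 'k::field) mpoly ring)"
  proof (rule abelian_groupI)
    fix p :: "('x, 'k::field) mpoly" assume "p \<in> carrier (mpoly_ring X)"
    then have "- p \<in> carrier (mpoly_ring X)" by (auto simp: in_keys_iff simp del: lookup_not_eq_zero_eq_in_keys)
    moreover have "- p \<oplus>\<^bsub>mpoly_ring X\<^esub> p = \<zero>\<^bsub>mpoly_ring X\<^esub>" by simp
    ultimately show "\<exists>q \<in> carrier (mpoly_ring X). q \<oplus>\<^bsub>mpoly_ring X\<^esub> p = \<zero>\<^bsub>mpoly_ring X\<^esub>" by blast
  next
    fix p q :: "('x, 'k::field) mpoly"
    assume "p \<in> carrier (mpoly_ring X)" "q \<in> carrier (mpoly_ring X)"
    then show "p \<oplus>\<^bsub>mpoly_ring X\<^esub> q \<in> carrier (mpoly_ring X)"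
      using mpoly_carrier_add by (metis mpoly_ring_simps(5))
  qed (simp_all add: ac_simps)
  show "comm_monoid (mpoly_ring X :: ('x, 'k::field) mpoly ring)"
  proof (rule comm_monoidI)
    fix p q :: "('x, 'k::field) mpoly"
    assume "p \<in> carrier (mpoly_ring X)" "q \<in> carrier (mpoly_ring X)"
    then show "p \<otimes>\<^bsub>mpoly_ring X\<^esub> q \<in> carrier (mpoly_ring X)"
      using mpoly_carrier_mult by (metis mpoly_ring_simps(2))
  qed (simp_all add: ac_simps)
qed (simp add: distrib_right)

lemma mpoly_carrier_sum:
  "(\<And>i. i \<in> A \<Longrightarrow> f i \<in> carrier (mpoly_ring X)) \<Longrightarrow> sum f A \<in> carrier (mpoly_ring X)"
proof (induction A rule: infinite_finite_induct)
  case (insert x F)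
  then show ?case by (simp add: mpoly_carrier_add del: mpoly_ring_simps(1))
qed simp_all

lemma mpoly_carrier_power:
  "p \<in> carrier (mpoly_ring X) \<Longrightarrow> p ^ n \<in> carrier (mpoly_ring X)"
proof (induction n)
  case (Suc n)
  then show ?case by (simp add: mpoly_carrier_mult del: mpoly_ring_simps(1))
qed simp

lemma mpoly_carrier_prod:
  "(\<And>i. i \<in> A \<Longrightarrow> f i \<in> carrier (mpoly_ring X)) \<Longrightarrow> prod f A \<in> carrier (mpoly_ring X)"
proof (induction A rule: infinite_finite_induct)
  case (insert x F)
  then show ?case by (simp add: mpoly_carrier_mult del: mpoly_ring_simps(1))
qed simp_all

lemma mpoly_subst_superset:
  assumes "finite A" "Poly_Mapping.keys p \<subseteq> A"
  shows "mpoly_subst f p =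
    (\<Sum>m \<in> A. Poly_Mapping.single 0 (Poly_Mapping.lookup p m)
        * (\<Prod>x \<in> Poly_Mapping.keys m. f x ^ Poly_Mapping.lookup m x))"
  unfolding mpoly_subst_def
  by (rule sum.mono_neutral_left) (use assms in \<open>auto simp: in_keys_iff simp del: lookup_not_eq_zero_eq_in_keys\<close>)

lemma mpoly_subst_add: "mpoly_subst f (p + q) = mpoly_subst f p + mpoly_subst f q"
proof -
  let ?A = "Poly_Mapping.keys p \<union> Poly_Mapping.keys q"
  have "Poly_Mapping.keys (p + q) \<subseteq> ?A" by (rule keys_add)
  then show ?thesis
    by (simp add: mpoly_subst_superset[of ?A] lookup_add single_add distrib_right sum.distrib)
qed

lemma mpoly_subst_zero [simp]: "mpoly_subst f 0 = 0"
  by (simp add: mpoly_subst_def)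

lemma mpoly_subst_sum: "mpoly_subst f (sum g A) = (\<Sum>i \<in> A. mpoly_subst f (g i))"
  by (induction A rule: infinite_finite_induct) (simp_all add: mpoly_subst_add)

lemma mpoly_subst_single:
  "mpoly_subst f (Poly_Mapping.single m c) =
    Poly_Mapping.single 0 c * (\<Prod>x \<in> Poly_Mapping.keys m. f x ^ Poly_Mapping.lookup m x)"
  by (simp add: mpoly_subst_def)

lemma mpoly_subst_var [simp]: "mpoly_subst f (mpoly_var x) = f x"
  by (simp add: mpoly_var_def mpoly_subst_single)

lemma mpoly_sum_single:
  "p = (\<Sum>m \<in> Poly_Mapping.keys p. Poly_Mapping.single m (Poly_Mapping.lookup p m))"
  by (rule poly_mapping_eqI)
    (auto simp: lookup_sum lookup_single when_def in_keys_iff sum.delta simp del: lookup_not_eq_zero_eq_in_keys)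

lemma mpoly_subst_mult:
  fixes f :: "'x \<Rightarrow> ('y, 'k::field) mpoly"
  shows "mpoly_subst f (p * q) = mpoly_subst f p * mpoly_subst f q"
proof -
  let ?e = "\<lambda>m. \<Prod>x \<in> Poly_Mapping.keys m. f x ^ Poly_Mapping.lookup m x"
  have e: "?e (m + n) = ?e m * ?e n" for m n
  proof -
    have "?e m = (\<Prod>x \<in> Poly_Mapping.keys (m + n). f x ^ Poly_Mapping.lookup m x)"
      by (rule prod.mono_neutral_left) (auto simp: keys_add_nat in_keys_iff simp del: lookup_not_eq_zero_eq_in_keys)
    moreover have "?e n = (\<Prod>x \<in> Poly_Mapping.keys (m + n). f x ^ Poly_Mapping.lookup n x)"
      by (rule prod.mono_neutral_left) (auto simp: keys_add_nat in_keys_iff simp del: lookup_not_eq_zero_eq_in_keys)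
    ultimately show ?thesis
      by (simp add: lookup_add power_add prod.distrib)
  qed
  have s: "mpoly_subst f (Poly_Mapping.single m a * Poly_Mapping.single n b) =
      mpoly_subst f (Poly_Mapping.single m a) * mpoly_subst f (Poly_Mapping.single n b)" for m n a b
  proof -
    have c: "Poly_Mapping.single 0 (a * b) =
        (Poly_Mapping.single 0 a * Poly_Mapping.single 0 b :: ('y, 'k) mpoly)"
      by (simp add: mult_single)
    show ?thesis
      unfolding mult_single mpoly_subst_single e unfolding c by (simp only: mult_ac)
  qed
  define P where "P = (\<lambda>m. Poly_Mapping.single m (Poly_Mapping.lookup p m))"
  define Q where "Q = (\<lambda>m. Poly_Mapping.single m (Poly_Mapping.lookup q m))"
  have P: "p = sum P (Poly_Mapping.keys p)" and Q: "q = sum Q (Poly_Mapping.keys q)"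
    unfolding P_def Q_def by (rule mpoly_sum_single)+
  have "mpoly_subst f (sum P A * sum Q B) = mpoly_subst f (sum P A) * mpoly_subst f (sum Q B)" for A B
    unfolding sum_product mpoly_subst_sum by (simp add: P_def Q_def s)
  then show ?thesis
    using P Q by metis
qed

lemma mpoly_subst_ring_hom:
  fixes f :: "'x \<Rightarrow> ('y, 'k::field) mpoly"
  assumes "\<And>x. x \<in> X \<Longrightarrow> f x \<in> carrier (mpoly_ring Y)"
  shows "mpoly_subst f \<in> ring_hom (mpoly_ring X) (mpoly_ring Y)"
proof (rule ring_hom_memI)
  fix p :: "('x, 'k) mpoly" assume p: "p \<in> carrier (mpoly_ring X)"
  show "mpoly_subst f p \<in> carrier (mpoly_ring Y)"
    unfolding mpoly_subst_def
  proof (intro mpoly_carrier_sum mpoly_carrier_mult mpoly_carrier_prod mpoly_carrier_power assms)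
    fix m x assume "m \<in> Poly_Mapping.keys p" "x \<in> Poly_Mapping.keys m"
    then show "x \<in> X" using p by auto
  qed simp
next
  show "mpoly_subst f \<one>\<^bsub>mpoly_ring X\<^esub> = \<one>\<^bsub>mpoly_ring Y\<^esub>"
    by (simp add: mpoly_subst_def)
qed (simp_all add: mpoly_subst_add mpoly_subst_mult)


section \<open>Toric ideals and toric fiber products\<close>

definition toric_ideal :: "'t set \<Rightarrow> ('t \<Rightarrow> 'd \<Rightarrow>\<^sub>0 nat) \<Rightarrow> ('t, 'k::field) mpoly set" where
  "toric_ideal T v = Idl\<^bsub>mpoly_ring T\<^esub>
    {Poly_Mapping.single u 1 - Poly_Mapping.single w 1 | u w.
       Poly_Mapping.keys u \<subseteq> T \<and> Poly_Mapping.keys w \<subseteq> T \<and>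
       (\<forall>d. (\<Sum>t \<in> Poly_Mapping.keys u. Poly_Mapping.lookup u t * Poly_Mapping.lookup (v t) d) =
            (\<Sum>t \<in> Poly_Mapping.keys w. Poly_Mapping.lookup w t * Poly_Mapping.lookup (v t) d))}"

text \<open>The vector \<open>(b, c)\<close> in the direct sum.\<close>

definition vec_pair :: "('d1 \<Rightarrow>\<^sub>0 nat) \<Rightarrow> ('d2 \<Rightarrow>\<^sub>0 nat) \<Rightarrow> ('d1 + 'd2) \<Rightarrow>\<^sub>0 nat" where
  "vec_pair b c =
    Abs_poly_mapping (case_sum (Poly_Mapping.lookup b) (Poly_Mapping.lookup c))"

lemma lookup_vec_pair:
  "Poly_Mapping.lookup (vec_pair b c) = case_sum (Poly_Mapping.lookup b) (Poly_Mapping.lookup c)"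
proof -
  have "{x. case_sum (Poly_Mapping.lookup b) (Poly_Mapping.lookup c) x \<noteq> 0}
      \<subseteq> Inl ` Poly_Mapping.keys b \<union> Inr ` Poly_Mapping.keys c"
  proof
    fix x assume "x \<in> {x. case_sum (Poly_Mapping.lookup b) (Poly_Mapping.lookup c) x \<noteq> 0}"
    then show "x \<in> Inl ` Poly_Mapping.keys b \<union> Inr ` Poly_Mapping.keys c"
      by (cases x) (auto simp: in_keys_iff simp del: lookup_not_eq_zero_eq_in_keys)
  qed
  then have "finite {x. case_sum (Poly_Mapping.lookup b) (Poly_Mapping.lookup c) x \<noteq> 0}"
    by (rule finite_subset) simp
  then show ?thesis
    unfolding vec_pair_def by simp
qed

text \<open>
  Families \<open>a\<close>, \<open>b\<close>, \<open>c\<close> of vectors \<open>a\<^sup>i\<close>, \<open>b\<^sup>i\<^sub>j\<close>, \<open>c\<^sup>i\<^sub>k\<close> with \<open>i \<in> N\<close>, \<open>j \<in> J i\<close>, \<open>k \<in> K i\<close>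
  for which the toric fiber product is defined.  Linear maps are taken between the free abelian
  groups on the coordinate types; a linear map between free abelian groups on finite subsets of
  the coordinates extends by zero, so this does not change which families admit such maps.
\<close>

definition toric_fiber_data ::
  "'i set \<Rightarrow> ('i \<Rightarrow> 'j set) \<Rightarrow> ('i \<Rightarrow> 'l set) \<Rightarrow> ('i \<Rightarrow> 'e \<Rightarrow>\<^sub>0 nat) \<Rightarrow>
   ('i \<Rightarrow> 'j \<Rightarrow> 'd1 \<Rightarrow>\<^sub>0 nat) \<Rightarrow> ('i \<Rightarrow> 'l \<Rightarrow> 'd2 \<Rightarrow>\<^sub>0 nat) \<Rightarrow> bool" where
  "toric_fiber_data N J K a b c \<longleftrightarrow>
     finite N \<and> (\<forall>i \<in> N. finite (J i) \<and> finite (K i)) \<and>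
     (\<exists>\<pi>1 :: ('d1 \<Rightarrow>\<^sub>0 int) \<Rightarrow> ('e \<Rightarrow>\<^sub>0 int). additive \<pi>1 \<and>
        (\<forall>i \<in> N. \<forall>j \<in> J i. \<pi>1 (Poly_Mapping.map int (b i j)) = Poly_Mapping.map int (a i))) \<and>
     (\<exists>\<pi>2 :: ('d2 \<Rightarrow>\<^sub>0 int) \<Rightarrow> ('e \<Rightarrow>\<^sub>0 int). additive \<pi>2 \<and>
        (\<forall>i \<in> N. \<forall>k \<in> K i. \<pi>2 (Poly_Mapping.map int (c i k)) = Poly_Mapping.map int (a i)))"

definition toric_fiber_index ::
  "'i set \<Rightarrow> ('i \<Rightarrow> 'j set) \<Rightarrow> ('i \<Rightarrow> 'l set) \<Rightarrow> ('i \<times> 'j \<times> 'l) set" where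
  "toric_fiber_index N J K = (SIGMA i:N. J i \<times> K i)"

definition toric_fiber_product ::
  "'i set \<Rightarrow> ('i \<Rightarrow> 'j set) \<Rightarrow> ('i \<Rightarrow> 'l set) \<Rightarrow>
   ('i \<Rightarrow> 'j \<Rightarrow> 'd1 \<Rightarrow>\<^sub>0 nat) \<Rightarrow> ('i \<Rightarrow> 'l \<Rightarrow> 'd2 \<Rightarrow>\<^sub>0 nat) \<Rightarrow>
   ('i \<times> 'j \<times> 'l, 'k::field) mpoly set" where
  "toric_fiber_product N J K b c =
     toric_ideal (toric_fiber_index N J K) (\<lambda>(i, j, k). vec_pair (b i j) (c i k))"


section \<open>Graphs and homomorphisms\<close>

text \<open>An edge is the set of its endpoints, so a loop is a singleton.\<close>

record 'v graph =
  verts :: "'v set"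
  edges :: "'v set set"

definition is_graph :: "'v graph \<Rightarrow> bool" where
  "is_graph G \<longleftrightarrow> finite (verts G) \<and> (\<forall>e \<in> edges G. \<exists>u \<in> verts G. \<exists>v \<in> verts G. e = {u, v})"

definition graph_inter :: "'v graph \<Rightarrow> 'v graph \<Rightarrow> 'v graph" where
  "graph_inter G1 G2 = \<lparr>verts = verts G1 \<inter> verts G2, edges = edges G1 \<inter> edges G2\<rparr>"

definition graph_union :: "'v graph \<Rightarrow> 'v graph \<Rightarrow> 'v graph" where
  "graph_union G1 G2 = \<lparr>verts = verts G1 \<union> verts G2, edges = edges G1 \<union> edges G2\<rparr>"

definition induced_subgraph :: "'v graph \<Rightarrow> 'v graph \<Rightarrow> bool" where
  "induced_subgraph F G \<longleftrightarrow>
     verts F \<subseteq> verts G \<and> edges F = {e \<in> edges G. e \<subseteq> verts F}"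

definition edge_graph :: "'v set \<Rightarrow> 'v graph" where
  "edge_graph e = \<lparr>verts = e, edges = {e}\<rparr>"

text \<open>
  Maps on \<open>verts G\<close> are functions that are \<open>undefined\<close> elsewhere, so that
  homomorphisms correspond to elements of \<open>graph_hom G H\<close> one to one.
\<close>

definition graph_hom :: "'v graph \<Rightarrow> 'w graph \<Rightarrow> ('v \<Rightarrow> 'w) set" where
  "graph_hom G H =
     {\<phi> \<in> verts G \<rightarrow>\<^sub>E verts H. \<forall>u v. {u, v} \<in> edges G \<longrightarrow> {\<phi> u, \<phi> v} \<in> edges H}"

section \<open>The ideals of graph homomorphisms\<close>

definition hom_source_ring :: "'v graph \<Rightarrow> 'w graph \<Rightarrow> ('v \<Rightarrow> 'w, 'k::field) mpoly ring" where
  "hom_source_ring G H = mpoly_ring (graph_hom G H)"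

definition hom_target_ring ::
  "'v graph \<Rightarrow> 'w graph \<Rightarrow> ('v set \<times> ('v \<Rightarrow> 'w), 'k::field) mpoly ring" where
  "hom_target_ring G H = mpoly_ring (SIGMA e:edges G. graph_hom (edge_graph e) H)"

definition hom_map ::
  "'v graph \<Rightarrow> ('v \<Rightarrow> 'w, 'k::field) mpoly \<Rightarrow> ('v set \<times> ('v \<Rightarrow> 'w), 'k) mpoly" where
  "hom_map G = mpoly_subst (\<lambda>\<phi>. \<Prod>e \<in> edges G. mpoly_var (e, restrict \<phi> e))"

definition hom_ideal :: "'v graph \<Rightarrow> 'w graph \<Rightarrow> ('v \<Rightarrow> 'w, 'k::field) mpoly set" where
  "hom_ideal G H = a_kernel (hom_source_ring G H) (hom_target_ring G H) (hom_map G)"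

definition hom_vector :: "'v graph \<Rightarrow> ('v \<Rightarrow> 'w) \<Rightarrow> ('v set \<times> ('v \<Rightarrow> 'w)) \<Rightarrow>\<^sub>0 nat" where
  "hom_vector G \<phi> = (\<Sum>e \<in> edges G. Poly_Mapping.single (e, restrict \<phi> e) 1)"

text \<open>\<open>hom_vector G \<phi>\<close> is the exponent vector of the image of the variable \<open>r\<^sub>\<phi>\<close>.\<close>

lemma prod_mpoly_var: "(\<Prod>e \<in> A. mpoly_var (g e)) =
    Poly_Mapping.single (\<Sum>e \<in> A. Poly_Mapping.single (g e) 1) 1"
  by (induction A rule: infinite_finite_induct) (simp_all add: mpoly_var_def mult_single)

lemma hom_map_var: "hom_map G (mpoly_var \<phi>) = Poly_Mapping.single (hom_vector G \<phi>) 1"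
  by (simp add: hom_map_def hom_vector_def prod_mpoly_var)

lemma hom_map_ring_hom:
  assumes "is_graph G"
  shows "hom_map G \<in> ring_hom (hom_source_ring G H) (hom_target_ring G H)"
  unfolding hom_map_def hom_source_ring_def hom_target_ring_def
proof (intro mpoly_subst_ring_hom mpoly_carrier_prod)
  fix \<phi> e assume \<phi>: "\<phi> \<in> graph_hom G H" and e: "e \<in> edges G"
  have "e \<subseteq> verts G"
    using assms e by (auto simp: is_graph_def)
  then have "restrict \<phi> e \<in> graph_hom (edge_graph e) H"
    using \<phi> e by (auto simp: graph_hom_def edge_graph_def)
  then show "mpoly_var (e, restrict \<phi> e)
      \<in> carrier (mpoly_ring (SIGMA e:edges G. graph_hom (edge_graph e) H))"
    using e by (simp add: mpoly_var_def)
qed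

text \<open>
  \<open>hom_vector G\<close> is the vector configuration defining \<open>hom_ideal G H\<close>.
\<close>

lemma hom_ideal_eq_toric_ideal:
  assumes G: "is_graph G"
  shows "hom_ideal G H = (toric_ideal (graph_hom G H) (hom_vector G) :: ('v \<Rightarrow> 'w, 'k::field) mpoly set)"
proof -
  define R where "R = (hom_source_ring G H :: ('v \<Rightarrow> 'w, 'k) mpoly ring)"
  define S where "S = (hom_target_ring G H :: ('v set \<times> ('v \<Rightarrow> 'w), 'k) mpoly ring)"
  define h where "h = (hom_map G :: ('v \<Rightarrow> 'w, 'k) mpoly \<Rightarrow> _)"
  define wt where "wt = (\<lambda>m. \<Sum>\<phi> \<in> Poly_Mapping.keys m.
    Poly_Mapping.map ((*) (Poly_Mapping.lookup m \<phi>)) (hom_vector G (\<phi> :: 'v \<Rightarrow> 'w)))"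
  define B where "B = {Poly_Mapping.single u 1 - Poly_Mapping.single w 1 :: ('v \<Rightarrow> 'w, 'k) mpoly | u w.
       Poly_Mapping.keys u \<subseteq> graph_hom G H \<and> Poly_Mapping.keys w \<subseteq> graph_hom G H \<and>
       (\<forall>d. (\<Sum>t \<in> Poly_Mapping.keys u. Poly_Mapping.lookup u t * Poly_Mapping.lookup (hom_vector G t) d) =
            (\<Sum>t \<in> Poly_Mapping.keys w. Poly_Mapping.lookup w t * Poly_Mapping.lookup (hom_vector G t) d))}"
  have crR: "cring R" and crS: "cring S"
    by (simp_all add: R_def S_def hom_source_ring_def hom_target_ring_def cring_mpoly_ring)
  interpret R: cring R by (rule crR)
  interpret S: cring S by (rule crS)
  have hh: "h \<in> ring_hom R S"
    unfolding h_def R_def S_def by (rule hom_map_ring_hom[OF G])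
  interpret h: ring_hom_ring R S h
    by (rule ring_hom_ringI2[OF R.ring_axioms S.ring_axioms hh])
  have lookup_wt: "Poly_Mapping.lookup (wt u) d =
      (\<Sum>t \<in> Poly_Mapping.keys u. Poly_Mapping.lookup u t * Poly_Mapping.lookup (hom_vector G t) d)" for u d
    by (simp add: wt_def lookup_sum map.rep_eq when_def) (rule sum.cong; simp)
  then have B: "B = {Poly_Mapping.single u 1 - Poly_Mapping.single w 1 | u w.
       Poly_Mapping.keys u \<subseteq> graph_hom G H \<and> Poly_Mapping.keys w \<subseteq> graph_hom G H \<and> wt u = wt w}"
    unfolding B_def by (simp add: poly_mapping_eq_iff fun_eq_iff)
  have pow: "Poly_Mapping.single v (1 :: 'k) ^ n = Poly_Mapping.single (Poly_Mapping.map ((*) n) v) 1"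
    for v :: "('v set \<times> ('v \<Rightarrow> 'w)) \<Rightarrow>\<^sub>0 nat" and n
  proof (induction n)
    case 0
    have "Poly_Mapping.map ((*) 0) v = 0"
      by (rule poly_mapping_eqI) (simp add: map.rep_eq when_def)
    then show ?case by (simp only: power_0 single_one)
  next
    case (Suc n)
    have "v + Poly_Mapping.map ((*) n) v = Poly_Mapping.map ((*) (Suc n)) v"
      by (rule poly_mapping_eqI) (simp add: map.rep_eq when_def lookup_add)
    then show ?case by (simp only: power_Suc Suc mult_single mult_1)
  qed
  have prd: "(\<Prod>i \<in> A. Poly_Mapping.single (f i) (1 :: 'k)) = Poly_Mapping.single (sum f A) 1"
    for A and f :: "_ \<Rightarrow> ('v set \<times> ('v \<Rightarrow> 'w)) \<Rightarrow>\<^sub>0 nat"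
    by (induction A rule: infinite_finite_induct) (simp_all add: mult_single)
  have h_single: "h (Poly_Mapping.single m c) = Poly_Mapping.single (wt m) c" for m c
  proof -
    have "(\<Prod>e \<in> edges G. mpoly_var (e, restrict \<phi> e)) = Poly_Mapping.single (hom_vector G \<phi>) (1 :: 'k)"
      for \<phi> :: "'v \<Rightarrow> 'w"
      by (simp add: hom_vector_def prod_mpoly_var)
    then show ?thesis
      by (simp add: h_def hom_map_def mpoly_subst_single pow prd wt_def mult_single)
  qed
  have h_add: "h (p + q) = h p + h q" for p q
    by (simp add: h_def hom_map_def mpoly_subst_add)
  have h_diff: "h (p - q) = h p - h q" for p q
    using h_add[of "p - q" q] by (simp add: algebra_simps)
  have car: "carrier R = {p. \<forall>m \<in> Poly_Mapping.keys p. Poly_Mapping.keys m \<subseteq> graph_hom G H}"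
    and opR: "\<And>x y. x \<oplus>\<^bsub>R\<^esub> y = x + y" "\<And>x y. x \<otimes>\<^bsub>R\<^esub> y = x * y" "\<zero>\<^bsub>R\<^esub> = 0" and zS: "\<zero>\<^bsub>S\<^esub> = 0"
    by (simp_all add: R_def S_def hom_source_ring_def hom_target_ring_def)
  have ker: "a_kernel R S h = {p \<in> carrier R. h p = 0}"
    unfolding a_kernel_def' zS ..
  have Bker: "B \<subseteq> a_kernel R S h"
  proof
    fix b assume "b \<in> B"
    then obtain u w where b: "b = Poly_Mapping.single u 1 - Poly_Mapping.single w 1"
      and k: "Poly_Mapping.keys u \<subseteq> graph_hom G H" "Poly_Mapping.keys w \<subseteq> graph_hom G H"
      and w: "wt u = wt w"
      using B by auto
    have "Poly_Mapping.keys b \<subseteq> {u, w}"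
      unfolding b by (auto simp: in_keys_iff lookup_minus lookup_single when_def
          simp del: lookup_not_eq_zero_eq_in_keys split: if_splits)
    then have "b \<in> carrier R" using k unfolding car by auto
    moreover have "h b = 0" by (simp add: b h_diff h_single w)
    ultimately show "b \<in> a_kernel R S h" by (simp add: ker)
  qed
  have Bcar: "B \<subseteq> carrier R" using Bker ker by auto
  have id: "ideal (Idl\<^bsub>R\<^esub> B) R" by (rule R.genideal_ideal[OF Bcar])
  have "p \<in> Idl\<^bsub>R\<^esub> B" if "p \<in> carrier R" "h p = 0" for p
    using that
  proof (induction "card (Poly_Mapping.keys p)" arbitrary: p rule: less_induct)
    case less
    show ?case
    proof (cases "p = 0")
      case True
      then show ?thesis
        using additive_subgroup.zero_closed[OF ideal.axioms(1)[OF id]] by (simp add: opR)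
    next
      case False
      then obtain m where m: "m \<in> Poly_Mapping.keys p" by fastforce
      define c where "c = Poly_Mapping.lookup p m"
      have "h p = (\<Sum>n \<in> Poly_Mapping.keys p. Poly_Mapping.single (wt n) (Poly_Mapping.lookup p n))"
      proof -
        have "h (sum f A) = (\<Sum>n \<in> A. h (f n))" for f and A :: "(('v \<Rightarrow> 'w) \<Rightarrow>\<^sub>0 nat) set"
          unfolding h_def hom_map_def by (rule mpoly_subst_sum)
        then show ?thesis
          by (subst mpoly_sum_single[of p]) (simp only: h_single)
      qed
      then have "Poly_Mapping.lookup (h p) (wt m) = (\<Sum>n \<in> Poly_Mapping.keys p. Poly_Mapping.lookup (Poly_Mapping.single (wt n) (Poly_Mapping.lookup p n)) (wt m))"
        by (simp only: lookup_sum)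
      then have z: "0 = (\<Sum>n \<in> Poly_Mapping.keys p. Poly_Mapping.lookup (Poly_Mapping.single (wt n) (Poly_Mapping.lookup p n)) (wt m))"
        unfolding less.prems(2) lookup_zero .
      have "\<exists>n \<in> Poly_Mapping.keys p. n \<noteq> m \<and> wt n = wt m"
      proof (rule ccontr)
        assume "\<not> ?thesis"
        then have "(\<Sum>n \<in> Poly_Mapping.keys p. Poly_Mapping.lookup (Poly_Mapping.single (wt n) (Poly_Mapping.lookup p n)) (wt m))
            = (\<Sum>n \<in> Poly_Mapping.keys p. if n = m then c else 0)"
          by (intro sum.cong) (auto simp: lookup_single when_def c_def)
        then have "0 = c" using z m by simp
        then show False using m unfolding c_def by (metis lookup_not_eq_zero_eq_in_keys)
      qed
      then obtain n where n: "n \<in> Poly_Mapping.keys p" "n \<noteq> m" "wt n = wt m" by blast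
      define b :: "('v \<Rightarrow> 'w, 'k) mpoly" where "b = Poly_Mapping.single m 1 - Poly_Mapping.single n 1"
      define C :: "('v \<Rightarrow> 'w, 'k) mpoly" where "C = Poly_Mapping.single 0 c"
      have km: "Poly_Mapping.keys m \<subseteq> graph_hom G H" and kn: "Poly_Mapping.keys n \<subseteq> graph_hom G H"
        using less.prems(1) m n unfolding car by auto
      have bB: "b \<in> B" unfolding B b_def using km kn n(3)[symmetric] by blast
      have CR: "C \<in> carrier R" unfolding car C_def by simp
      have Cb: "C * b = Poly_Mapping.single m c - Poly_Mapping.single n c"
        by (simp add: C_def b_def right_diff_distrib mult_single)
      define q where "q = p - C * b"
      have kq: "Poly_Mapping.keys q \<subseteq> Poly_Mapping.keys p - {m}"
        using n unfolding q_def Cb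
        by (auto simp: in_keys_iff lookup_minus lookup_single when_def c_def
            simp del: lookup_not_eq_zero_eq_in_keys split: if_splits)
      have "card (Poly_Mapping.keys q) < card (Poly_Mapping.keys p)"
        by (rule psubset_card_mono) (use kq m in auto)
      moreover have "q \<in> carrier R" using kq less.prems(1) unfolding car by auto
      moreover have "h q = 0"
        by (simp add: q_def Cb h_diff h_single n(3) less.prems(2))
      ultimately have q: "q \<in> Idl\<^bsub>R\<^esub> B" using less.hyps by blast
      have "b \<in> Idl\<^bsub>R\<^esub> B" using R.genideal_self[OF Bcar] bB by auto
      then have "C * b \<in> Idl\<^bsub>R\<^esub> B" using ideal.I_l_closed[OF id _ CR] by (simp add: opR)
      then have "q + C * b \<in> Idl\<^bsub>R\<^esub> B"
        using additive_subgroup.a_closed[OF ideal.axioms(1)[OF id] q] by (simp add: opR)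
      then show ?thesis by (simp add: q_def)
    qed
  qed
  then have "a_kernel R S h \<subseteq> Idl\<^bsub>R\<^esub> B" by (auto simp: ker)
  moreover have "Idl\<^bsub>R\<^esub> B \<subseteq> a_kernel R S h"
    by (rule R.genideal_minimal[OF h.kernel_is_ideal Bker])
  ultimately have "a_kernel R S h = Idl\<^bsub>R\<^esub> B" by blast
  then show ?thesis
    unfolding hom_ideal_def toric_ideal_def R_def S_def h_def B_def hom_source_ring_def .
qed

text \<open>
  The families \<open>B\<close> and \<open>C\<close> indexing the fiber product over \<open>F\<close>:
  \<open>hom_fiber F G H i\<close> is the set of homomorphisms \<open>G \<rightarrow> H\<close> restricting to \<open>i\<close> on \<open>F\<close>.
\<close>

definition hom_fiber :: "'v graph \<Rightarrow> 'v graph \<Rightarrow> 'w graph \<Rightarrow> ('v \<Rightarrow> 'w) \<Rightarrow> ('v \<Rightarrow> 'w) set" where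
  "hom_fiber F G H i = {\<phi> \<in> graph_hom G H. restrict \<phi> (verts F) = i}"

text \<open>
  The identification of index triples \<open>(i, \<phi>1, \<phi>2)\<close> with homomorphisms from the union; outside
  \<open>verts G1\<close> the glued map is \<open>\<phi>2\<close>, hence \<open>undefined\<close> outside \<open>verts G1 \<union> verts G2\<close>.
\<close>

definition hom_glue :: "'v graph \<Rightarrow> ('v \<Rightarrow> 'w) \<times> ('v \<Rightarrow> 'w) \<times> ('v \<Rightarrow> 'w) \<Rightarrow> 'v \<Rightarrow> 'w" where
  "hom_glue G1 = (\<lambda>(i, \<phi>1, \<phi>2) v. if v \<in> verts G1 then \<phi>1 v else \<phi>2 v)"

lemma hom_glue_bij:
  assumes "is_graph G1" "is_graph G2"
  defines "F \<equiv> graph_inter G1 G2"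
  shows "bij_betw (hom_glue G1)
    (toric_fiber_index (graph_hom F H) (hom_fiber F G1 H) (hom_fiber F G2 H))
    (graph_hom (graph_union G1 G2) H)"
    and "\<And>i \<phi>1 \<phi>2. (i, \<phi>1, \<phi>2) \<in> toric_fiber_index (graph_hom F H) (hom_fiber F G1 H) (hom_fiber F G2 H) \<Longrightarrow>
      restrict (hom_glue G1 (i, \<phi>1, \<phi>2)) (verts G1) = \<phi>1 \<and>
      restrict (hom_glue G1 (i, \<phi>1, \<phi>2)) (verts G2) = \<phi>2"
proof -
  let ?T = "toric_fiber_index (graph_hom F H) (hom_fiber F G1 H) (hom_fiber F G2 H)"
  let ?r = "\<lambda>\<phi> :: 'a \<Rightarrow> 'b. (restrict \<phi> (verts F), restrict \<phi> (verts G1), restrict \<phi> (verts G2))"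
  have VF: "verts F = verts G1 \<inter> verts G2" and EF: "edges F = edges G1 \<inter> edges G2"
    by (simp_all add: F_def graph_inter_def)
  have E1: "u \<in> verts G1 \<and> v \<in> verts G1" if "{u, v} \<in> edges G1" for u v
    using assms(1) that unfolding is_graph_def by (metis insert_iff singletonD)
  have E2: "u \<in> verts G2 \<and> v \<in> verts G2" if "{u, v} \<in> edges G2" for u v
    using assms(2) that unfolding is_graph_def by (metis insert_iff singletonD)
  have res: "restrict (hom_glue G1 (i, \<phi>1, \<phi>2)) (verts G1) = \<phi>1 \<and>
      restrict (hom_glue G1 (i, \<phi>1, \<phi>2)) (verts G2) = \<phi>2 \<and>
      hom_glue G1 (i, \<phi>1, \<phi>2) \<in> graph_hom (graph_union G1 G2) H \<and>
      i = restrict (hom_glue G1 (i, \<phi>1, \<phi>2)) (verts F)"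
    if t: "(i, \<phi>1, \<phi>2) \<in> ?T" for i \<phi>1 \<phi>2
  proof -
    have h1: "\<phi>1 \<in> graph_hom G1 H" and h2: "\<phi>2 \<in> graph_hom G2 H"
      and i1: "restrict \<phi>1 (verts F) = i" and i2: "restrict \<phi>2 (verts F) = i"
      using t by (auto simp: toric_fiber_index_def hom_fiber_def)
    have ag: "\<phi>1 v = \<phi>2 v" if "v \<in> verts G1" "v \<in> verts G2" for v
      using i1 i2 that VF by (metis IntI restrict_apply')
    have u1: "\<phi>1 v = undefined" if "v \<notin> verts G1" for v
      using h1 that by (auto simp: graph_hom_def PiE_def extensional_def)
    have u2: "\<phi>2 v = undefined" if "v \<notin> verts G2" for v
      using h2 that by (auto simp: graph_hom_def PiE_def extensional_def)
    have r1: "restrict (hom_glue G1 (i, \<phi>1, \<phi>2)) (verts G1) = \<phi>1"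
      by (rule ext) (auto simp: hom_glue_def u1)
    have r2: "restrict (hom_glue G1 (i, \<phi>1, \<phi>2)) (verts G2) = \<phi>2"
      by (rule ext) (auto simp: hom_glue_def u2 ag)
    have r3: "i = restrict (hom_glue G1 (i, \<phi>1, \<phi>2)) (verts F)"
      unfolding i1[symmetric] by (rule ext) (auto simp: hom_glue_def VF)
    have "hom_glue G1 (i, \<phi>1, \<phi>2) \<in> graph_hom (graph_union G1 G2) H"
      unfolding graph_hom_def
    proof (intro CollectI conjI allI impI PiE_I)
      fix v assume "v \<in> verts (graph_union G1 G2)"
      then show "hom_glue G1 (i, \<phi>1, \<phi>2) v \<in> verts H"
        using h1 h2 by (auto simp: graph_union_def graph_hom_def hom_glue_def PiE_def Pi_def)
    next
      fix v assume "v \<notin> verts (graph_union G1 G2)"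
      then show "hom_glue G1 (i, \<phi>1, \<phi>2) v = undefined"
        by (auto simp: graph_union_def hom_glue_def u2)
    next
      fix u v assume "{u, v} \<in> edges (graph_union G1 G2)"
      then consider "{u, v} \<in> edges G1" | "{u, v} \<in> edges G2"
        by (auto simp: graph_union_def)
      then show "{hom_glue G1 (i, \<phi>1, \<phi>2) u, hom_glue G1 (i, \<phi>1, \<phi>2) v} \<in> edges H"
      proof cases
        case 1
        then have "{\<phi>1 u, \<phi>1 v} \<in> edges H" using h1 by (simp add: graph_hom_def)
        then show ?thesis using E1[OF 1] by (simp add: hom_glue_def)
      next
        case 2
        then have "{\<phi>2 u, \<phi>2 v} \<in> edges H" using h2 by (simp add: graph_hom_def)
        moreover have "hom_glue G1 (i, \<phi>1, \<phi>2) w = \<phi>2 w" if "w \<in> verts G2" for w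
          using ag that by (simp add: hom_glue_def)
        ultimately show ?thesis using E2[OF 2] by simp
      qed
    qed
    then show ?thesis using r1 r2 r3 by simp
  qed
  show "bij_betw (hom_glue G1) ?T (graph_hom (graph_union G1 G2) H)"
  proof (rule bij_betw_byWitness[where f' = ?r])
    show "\<forall>t \<in> ?T. ?r (hom_glue G1 t) = t"
    proof
      fix t assume t: "t \<in> ?T"
      obtain i \<phi>1 \<phi>2 where "t = (i, \<phi>1, \<phi>2)" by (cases t) auto
      then show "?r (hom_glue G1 t) = t"
        using res[of i \<phi>1 \<phi>2] t by simp
    qed
    show "hom_glue G1 ` ?T \<subseteq> graph_hom (graph_union G1 G2) H"
    proof (rule image_subsetI)
      fix t assume t: "t \<in> ?T"
      obtain i \<phi>1 \<phi>2 where "t = (i, \<phi>1, \<phi>2)" by (cases t) auto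
      then show "hom_glue G1 t \<in> graph_hom (graph_union G1 G2) H"
        using res[of i \<phi>1 \<phi>2] t by simp
    qed
    show "\<forall>\<phi> \<in> graph_hom (graph_union G1 G2) H. hom_glue G1 (?r \<phi>) = \<phi>"
    proof
      fix \<phi> assume "\<phi> \<in> graph_hom (graph_union G1 G2) H"
      then have "\<phi> v = undefined" if "v \<notin> verts G1" "v \<notin> verts G2" for v
        using that by (auto simp: graph_hom_def graph_union_def PiE_def extensional_def)
      then show "hom_glue G1 (?r \<phi>) = \<phi>"
        by (intro ext) (auto simp: hom_glue_def)
    qed
    show "?r ` graph_hom (graph_union G1 G2) H \<subseteq> ?T"
    proof (rule image_subsetI)
      fix \<phi> assume "\<phi> \<in> graph_hom (graph_union G1 G2) H"
      then have v: "\<And>x. x \<in> verts G1 \<union> verts G2 \<Longrightarrow> \<phi> x \<in> verts H"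
        and e: "\<And>x y. {x, y} \<in> edges G1 \<union> edges G2 \<Longrightarrow> {\<phi> x, \<phi> y} \<in> edges H"
        by (auto simp: graph_hom_def graph_union_def PiE_def Pi_def)
      have "restrict \<phi> (verts F) \<in> graph_hom F H"
        using v e E1 E2 by (auto simp: graph_hom_def VF EF)
      moreover have "restrict \<phi> (verts G1) \<in> graph_hom G1 H"
        using v e E1 by (auto simp: graph_hom_def)
      moreover have "restrict \<phi> (verts G2) \<in> graph_hom G2 H"
        using v e E2 by (auto simp: graph_hom_def)
      moreover have "restrict (restrict \<phi> (verts G1)) (verts F) = restrict \<phi> (verts F)"
        "restrict (restrict \<phi> (verts G2)) (verts F) = restrict \<phi> (verts F)"
        by (auto simp: VF)
      ultimately show "?r \<phi> \<in> ?T"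
        by (auto simp: toric_fiber_index_def hom_fiber_def)
    qed
  qed
  show "restrict (hom_glue G1 (i, \<phi>1, \<phi>2)) (verts G1) = \<phi>1 \<and>
      restrict (hom_glue G1 (i, \<phi>1, \<phi>2)) (verts G2) = \<phi>2" if "(i, \<phi>1, \<phi>2) \<in> ?T" for i \<phi>1 \<phi>2
    using res[OF that] by simp
qed

end

theory Submission
  imports Defs "HOL-Algebra.QuotRing"
begin

text \<open>
  Let \<open>\<phi>\<close> be a homomorphism of the union.  Its vector has a coordinate for each edge and each map
  on the ends of that edge; the edges of \<open>G1\<close> only see \<open>\<phi>|\<^bsub>G1\<^esub>\<close>, those of \<open>G2\<close> only see \<open>\<phi>|\<^bsub>G2\<^esub>\<close>.
  So the vector of \<open>\<phi>\<close> and the pair of the vectors of its two restrictions have the same nonzero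
  coordinates, those of the common edges being repeated in the pair.  Both configurations
  therefore satisfy the same linear relations, and gluing identifies their toric ideals.
\<close>

section \<open>Pushing exponents and polynomials forward along a map of variables\<close>

definition exp_rename :: "('x \<Rightarrow> 'y) \<Rightarrow> ('x \<Rightarrow>\<^sub>0 nat) \<Rightarrow> 'y \<Rightarrow>\<^sub>0 nat" where
  "exp_rename g m = (\<Sum>x \<in> Poly_Mapping.keys m. Poly_Mapping.single (g x) (Poly_Mapping.lookup m x))"

text \<open>The indicator is written as a factor so that the right side is a weighted sum over the
  keys of \<open>m\<close>; later it becomes the weight \<open>c\<close> of
  \<open>sum_exp_rename\<close>.\<close>

lemma lookup_exp_rename:
  "Poly_Mapping.lookup (exp_rename g m) y =
    (\<Sum>x \<in> Poly_Mapping.keys m. Poly_Mapping.lookup m x * (if g x = y then 1 else 0))"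
  unfolding exp_rename_def lookup_sum by (rule sum.cong) (simp_all add: lookup_single when_def)

lemma keys_exp_rename: "Poly_Mapping.keys (exp_rename g m) \<subseteq> g ` Poly_Mapping.keys m"
proof
  fix y assume "y \<in> Poly_Mapping.keys (exp_rename g m)"
  then have "Poly_Mapping.lookup (exp_rename g m) y \<noteq> 0"
    by (simp add: in_keys_iff)
  then show "y \<in> g ` Poly_Mapping.keys m"
    unfolding lookup_exp_rename by (auto split: if_splits)
qed

text \<open>Each exponent of the renamed monomial collects the exponents over one fibre of
  \<open>g\<close>, so the sum can be regrouped by fibres. With \<open>c\<close> a coordinate of a
  vector family, this pulls linear relations back along \<open>g\<close>.\<close>

lemma sum_exp_rename:
  fixes c :: "'y \<Rightarrow> nat"
  shows "(\<Sum>y \<in> Poly_Mapping.keys (exp_rename g m). Poly_Mapping.lookup (exp_rename g m) y * c y) =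
    (\<Sum>x \<in> Poly_Mapping.keys m. Poly_Mapping.lookup m x * c (g x))"
proof -
  have "(\<Sum>y \<in> Poly_Mapping.keys (exp_rename g m). Poly_Mapping.lookup (exp_rename g m) y * c y) =
      (\<Sum>y \<in> g ` Poly_Mapping.keys m. Poly_Mapping.lookup (exp_rename g m) y * c y)"
    by (rule sum.mono_neutral_left[OF _ keys_exp_rename])
      (auto simp: in_keys_iff simp del: lookup_not_eq_zero_eq_in_keys)
  also have "\<dots> = (\<Sum>x \<in> Poly_Mapping.keys m. \<Sum>y \<in> g ` Poly_Mapping.keys m.
      if g x = y then Poly_Mapping.lookup m x * c y else 0)"
    unfolding lookup_exp_rename sum_distrib_right
    by (subst sum.swap) (intro sum.cong refl, simp)
  also have "\<dots> = (\<Sum>x \<in> Poly_Mapping.keys m. Poly_Mapping.lookup m x * c (g x))"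
    by (intro sum.cong refl) simp
  finally show ?thesis .
qed

lemma exp_rename_inverse:
  assumes "\<And>x. x \<in> Poly_Mapping.keys m \<Longrightarrow> g (f x) = x"
  shows "exp_rename g (exp_rename f m) = m"
proof (rule poly_mapping_eqI)
  fix x
  have "Poly_Mapping.lookup (exp_rename g (exp_rename f m)) x =
      (\<Sum>y \<in> Poly_Mapping.keys m. Poly_Mapping.lookup m y * (if g (f y) = x then 1 else 0))"
    unfolding lookup_exp_rename[of g] sum_exp_rename ..
  also have "\<dots> = (\<Sum>y \<in> Poly_Mapping.keys m. if y = x then Poly_Mapping.lookup m y else 0)"
    using assms by (intro sum.cong) auto
  also have "\<dots> = Poly_Mapping.lookup m x"
    by (simp add: in_keys_iff)
  finally show "Poly_Mapping.lookup (exp_rename g (exp_rename f m)) x = Poly_Mapping.lookup m x" .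
qed

lemma mpoly_var_power:
  "(mpoly_var x :: ('x, 'k::field) mpoly) ^ n = Poly_Mapping.single (Poly_Mapping.single x n) 1"
  by (induction n) (simp_all add: mpoly_var_def mult_single flip: single_add)

lemma prod_single_one:
  "(\<Prod>i \<in> A. Poly_Mapping.single (f i) (1 :: 'k::field)) = Poly_Mapping.single (\<Sum>i \<in> A. f i) 1"
  for f :: "'i \<Rightarrow> 'x \<Rightarrow>\<^sub>0 nat"
  by (induction A rule: infinite_finite_induct) (simp_all add: mult_single)

text \<open>Variables are replaced by variables, so a monomial stays a monomial with the same
  coefficient. Binomials are therefore sent to binomials, and only their exponents have to be
  followed.\<close>

lemma mpoly_rename_single:
  "mpoly_rename g (Poly_Mapping.single m (c :: 'k::field)) = Poly_Mapping.single (exp_rename g m) c"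
  by (simp add: mpoly_rename_def mpoly_subst_single mpoly_var_power prod_single_one mult_single
      exp_rename_def)

lemma mpoly_rename_diff: "mpoly_rename g (p - q) = mpoly_rename g p - mpoly_rename g q"
  using mpoly_subst_add[of "\<lambda>x. mpoly_var (g x)" "p - q" q]
  by (simp add: mpoly_rename_def algebra_simps)

lemma mpoly_rename_sum: "mpoly_rename g (\<Sum>i \<in> A. p i) = (\<Sum>i \<in> A. mpoly_rename g (p i))"
  unfolding mpoly_rename_def by (rule mpoly_subst_sum)

text \<open>The map \<open>g\<close> undoes \<open>f\<close> only on \<open>X\<close>, which is why
  \<open>p\<close> is confined to the variables in \<open>X\<close>; the claim then holds monomial
  by monomial.\<close>

lemma mpoly_rename_inverse:
  fixes p :: "('x, 'k::field) mpoly"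
  assumes "\<And>x. x \<in> X \<Longrightarrow> g (f x) = x" and "p \<in> carrier (mpoly_ring X)"
  shows "mpoly_rename g (mpoly_rename f p) = p"
proof -
  have "mpoly_rename g (mpoly_rename f p) =
      (\<Sum>m \<in> Poly_Mapping.keys p. Poly_Mapping.single (exp_rename g (exp_rename f m)) (Poly_Mapping.lookup p m))"
    by (subst mpoly_sum_single[of p]) (simp only: mpoly_rename_sum mpoly_rename_single)
  also have "\<dots> = (\<Sum>m \<in> Poly_Mapping.keys p. Poly_Mapping.single m (Poly_Mapping.lookup p m))"
  proof (intro sum.cong refl)
    fix m assume "m \<in> Poly_Mapping.keys p"
    then have "exp_rename g (exp_rename f m) = m"
      using assms by (intro exp_rename_inverse) auto
    then show "Poly_Mapping.single (exp_rename g (exp_rename f m)) (Poly_Mapping.lookup p m) =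
        Poly_Mapping.single m (Poly_Mapping.lookup p m)"
      by simp
  qed
  also have "\<dots> = p"
    by (rule mpoly_sum_single[symmetric])
  finally show ?thesis .
qed

section \<open>Toric ideals under a renaming of variables\<close>

lemma mpoly_binomial_carrier:
  assumes "Poly_Mapping.keys u \<subseteq> X" "Poly_Mapping.keys w \<subseteq> X"
  shows "Poly_Mapping.single u 1 - Poly_Mapping.single w 1
    \<in> carrier (mpoly_ring X :: ('x, 'k::field) mpoly ring)"
proof -
  have "Poly_Mapping.keys (Poly_Mapping.single u (1 :: 'k) - Poly_Mapping.single w 1) \<subseteq> {u, w}"
    by (auto simp: in_keys_iff lookup_minus lookup_single when_def
        simp del: lookup_not_eq_zero_eq_in_keys split: if_splits)
  then show ?thesis
    using assms by auto
qed

text \<open>The whole ring is an ideal containing the generators. This makes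
  \<open>mpoly_rename_inverse\<close> applicable to elements of a toric ideal.\<close>

lemma toric_ideal_carrier:
  "toric_ideal T v \<subseteq> carrier (mpoly_ring T :: ('t, 'k::field) mpoly ring)"
proof -
  interpret R: cring "mpoly_ring T :: ('t, 'k) mpoly ring"
    by (rule cring_mpoly_ring)
  show ?thesis
    unfolding toric_ideal_def
    by (intro R.genideal_minimal R.oneideal) (use mpoly_binomial_carrier in blast)
qed

text \<open>A relation among the \<open>v t\<close> holds coordinate by coordinate. If every
  coordinate of the family \<open>v' (g t)\<close> is a coordinate of \<open>v\<close> or vanishes
  on \<open>T\<close>, the same exponents satisfy the relation for \<open>v'\<close>. Several
  \<open>d'\<close> may share one \<open>d\<close>, so repeated coordinates do no harm.\<close>

lemma mpoly_rename_toric_ideal_subset: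
  fixes v :: "'t \<Rightarrow> 'd \<Rightarrow>\<^sub>0 nat" and v' :: "'s \<Rightarrow> 'e \<Rightarrow>\<^sub>0 nat"
  assumes g: "\<And>t. t \<in> T \<Longrightarrow> g t \<in> S"
    and coord: "\<And>d'. (\<exists>d. \<forall>t \<in> T. Poly_Mapping.lookup (v' (g t)) d' = Poly_Mapping.lookup (v t) d) \<or>
      (\<forall>t \<in> T. Poly_Mapping.lookup (v' (g t)) d' = 0)"
  shows "mpoly_rename g ` toric_ideal T v \<subseteq> (toric_ideal S v' :: ('s, 'k::field) mpoly set)"
proof -
  define R where "R = (mpoly_ring T :: ('t, 'k) mpoly ring)"
  define R' where "R' = (mpoly_ring S :: ('s, 'k) mpoly ring)"
  define rel where "rel = (\<lambda>u w. \<forall>d. (\<Sum>t \<in> Poly_Mapping.keys u. Poly_Mapping.lookup u t * Poly_Mapping.lookup (v t) d) =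
    (\<Sum>t \<in> Poly_Mapping.keys w. Poly_Mapping.lookup w t * Poly_Mapping.lookup (v t) d))"
  define rel' where "rel' = (\<lambda>u w. \<forall>d. (\<Sum>t \<in> Poly_Mapping.keys u. Poly_Mapping.lookup u t * Poly_Mapping.lookup (v' t) d) =
    (\<Sum>t \<in> Poly_Mapping.keys w. Poly_Mapping.lookup w t * Poly_Mapping.lookup (v' t) d))"
  define B where "B = {Poly_Mapping.single u 1 - Poly_Mapping.single w 1 :: ('t, 'k) mpoly | u w.
    Poly_Mapping.keys u \<subseteq> T \<and> Poly_Mapping.keys w \<subseteq> T \<and> rel u w}"
  define B' where "B' = {Poly_Mapping.single u 1 - Poly_Mapping.single w 1 :: ('s, 'k) mpoly | u w.
    Poly_Mapping.keys u \<subseteq> S \<and> Poly_Mapping.keys w \<subseteq> S \<and> rel' u w}"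
  have I: "toric_ideal T v = Idl\<^bsub>R\<^esub> B" and I': "toric_ideal S v' = Idl\<^bsub>R'\<^esub> B'"
    unfolding toric_ideal_def R_def R'_def B_def B'_def rel_def rel'_def by (rule refl)+
  interpret R: cring R unfolding R_def by (rule cring_mpoly_ring)
  interpret R': cring R' unfolding R'_def by (rule cring_mpoly_ring)
  have "mpoly_rename g \<in> ring_hom R R'"
    unfolding R_def R'_def mpoly_rename_def
    by (rule mpoly_subst_ring_hom) (use g in \<open>simp add: mpoly_var_def\<close>)
  then interpret h: ring_hom_ring R R' "mpoly_rename g"
    by (rule ring_hom_ringI2[OF R.ring_axioms R'.ring_axioms])
  have B'car: "B' \<subseteq> carrier R'"
    unfolding B'_def R'_def using mpoly_binomial_carrier by blast
  have "mpoly_rename g b \<in> B' \<and> b \<in> carrier R" if bB: "b \<in> B" for b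
  proof -
    obtain u w where b: "b = Poly_Mapping.single u 1 - Poly_Mapping.single w 1"
      and k: "Poly_Mapping.keys u \<subseteq> T" "Poly_Mapping.keys w \<subseteq> T" and r: "rel u w"
      using bB unfolding B_def by blast
    have "Poly_Mapping.keys (exp_rename g u) \<subseteq> S" "Poly_Mapping.keys (exp_rename g w) \<subseteq> S"
      using k g keys_exp_rename[of g u] keys_exp_rename[of g w] by blast+
    moreover have "rel' (exp_rename g u) (exp_rename g w)"
      unfolding rel'_def sum_exp_rename
    proof
      fix d'
      \<comment> \<open>The weight \<open>c\<close> is arbitrary so that both alternatives of
        \<open>coord\<close> are instances: \<open>c\<close> a coordinate of \<open>v\<close>, and
        \<open>c\<close> constantly 0.\<close>
      have eq: "(\<Sum>t \<in> Poly_Mapping.keys m. Poly_Mapping.lookup m t * Poly_Mapping.lookup (v' (g t)) d') =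
          (\<Sum>t \<in> Poly_Mapping.keys m. Poly_Mapping.lookup m t * c t)"
        if "Poly_Mapping.keys m \<subseteq> T" "\<forall>t \<in> T. Poly_Mapping.lookup (v' (g t)) d' = c t" for m c
        using that by (intro sum.cong) auto
      from coord[of d'] show "(\<Sum>t \<in> Poly_Mapping.keys u. Poly_Mapping.lookup u t * Poly_Mapping.lookup (v' (g t)) d') =
          (\<Sum>t \<in> Poly_Mapping.keys w. Poly_Mapping.lookup w t * Poly_Mapping.lookup (v' (g t)) d')"
      proof
        assume "\<exists>d. \<forall>t \<in> T. Poly_Mapping.lookup (v' (g t)) d' = Poly_Mapping.lookup (v t) d"
        then obtain d where d: "\<forall>t \<in> T. Poly_Mapping.lookup (v' (g t)) d' = Poly_Mapping.lookup (v t) d" ..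
        show ?thesis
          unfolding eq[OF k(1) d] eq[OF k(2) d] using r by (simp add: rel_def)
      next
        assume z: "\<forall>t \<in> T. Poly_Mapping.lookup (v' (g t)) d' = 0"
        show ?thesis
          unfolding eq[OF k(1) z] eq[OF k(2) z] by simp
      qed
    qed
    ultimately have "mpoly_rename g b \<in> B'"
      unfolding b mpoly_rename_diff mpoly_rename_single B'_def by blast
    then show ?thesis
      using mpoly_binomial_carrier[OF k] unfolding b R_def by blast
  qed
  \<comment> \<open>The preimage of an ideal under a ring homomorphism is an ideal, so it contains
    the ideal generated by \<open>B\<close> once it contains \<open>B\<close>.\<close>
  then have "B \<subseteq> {b \<in> carrier R. mpoly_rename g b \<in> Idl\<^bsub>R'\<^esub> B'}"
    using R'.genideal_self[OF B'car] by blast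
  then have "Idl\<^bsub>R\<^esub> B \<subseteq> {b \<in> carrier R. mpoly_rename g b \<in> Idl\<^bsub>R'\<^esub> B'}"
    by (intro R.genideal_minimal h.ideal_vimage R'.genideal_ideal B'car)
  then show ?thesis
    unfolding I I' by blast
qed

section \<open>Vectors of graph homomorphisms and their projections\<close>

lemma finite_edges: "is_graph G \<Longrightarrow> finite (edges G)"
  by (rule finite_subset[of _ "Pow (verts G)"]) (auto simp: is_graph_def)

lemma finite_graph_hom:
  assumes "is_graph G" "is_graph H"
  shows "finite (graph_hom G H)"
proof (rule finite_subset)
  show "graph_hom G H \<subseteq> verts G \<rightarrow>\<^sub>E verts H"
    by (auto simp: graph_hom_def)
  show "finite (verts G \<rightarrow>\<^sub>E verts H)"
    using assms by (auto simp: is_graph_def intro: finite_PiE)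
qed

text \<open>The edge is part of the coordinate, so the summands of different edges never meet and no
  entry exceeds 1.\<close>

lemma lookup_hom_vector:
  assumes "finite (edges G)"
  shows "Poly_Mapping.lookup (hom_vector G \<phi>) (e, \<psi>) =
    (if e \<in> edges G \<and> restrict \<phi> e = \<psi> then 1 else 0)"
proof -
  have "Poly_Mapping.lookup (hom_vector G \<phi>) (e, \<psi>) =
      (\<Sum>e' \<in> edges G. if e' = e then if restrict \<phi> e = \<psi> then 1 else 0 else 0)"
    unfolding hom_vector_def lookup_sum
    by (intro sum.cong refl) (auto simp: lookup_single when_def)
  then show ?thesis
    using assms by simp
qed

text \<open>Supplies both linear maps demanded by \<open>toric_fiber_data\<close>, with
  \<open>F\<close> the intersection: keep the coordinates of edges of \<open>F\<close> and drop the
  rest. An edge of \<open>F\<close> lies in \<open>verts F\<close>, where \<phi> agrees with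
  \<open>i\<close>, so the kept coordinates are those of \<open>i\<close>.\<close>

lemma hom_vector_projection:
  assumes F: "is_graph F" and G: "is_graph G" and sub: "edges F \<subseteq> edges G"
  shows "\<exists>\<pi> :: ('v set \<times> ('v \<Rightarrow> 'w) \<Rightarrow>\<^sub>0 int) \<Rightarrow> ('v set \<times> ('v \<Rightarrow> 'w) \<Rightarrow>\<^sub>0 int). additive \<pi> \<and>
    (\<forall>i. \<forall>\<phi> \<in> hom_fiber F G H i.
      \<pi> (Poly_Mapping.map int (hom_vector G \<phi>)) = Poly_Mapping.map int (hom_vector F i))"
proof (intro exI conjI allI ballI)
  \<comment> \<open>\<open>mapp\<close> acts on nonzero coordinates only; since the function sends 0
    to 0, \<open>lookup_\<pi>\<close> is valid at every coordinate.\<close>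
  define \<pi> :: "('v set \<times> ('v \<Rightarrow> 'w) \<Rightarrow>\<^sub>0 int) \<Rightarrow> ('v set \<times> ('v \<Rightarrow> 'w) \<Rightarrow>\<^sub>0 int)"
    where "\<pi> = Poly_Mapping.mapp (\<lambda>(e, \<psi>) x. if e \<in> edges F then x else 0)"
  have lookup_\<pi>: "Poly_Mapping.lookup (\<pi> x) (e, \<psi>) =
      (if e \<in> edges F then Poly_Mapping.lookup x (e, \<psi>) else 0)" for x e \<psi>
    by (simp add: \<pi>_def lookup_mapp when_def in_keys_iff)
  show "additive \<pi>"
    by unfold_locales (rule poly_mapping_eqI, auto simp: lookup_\<pi> lookup_add)
  fix i \<phi> assume "\<phi> \<in> hom_fiber F G H i"
  then have i: "i = restrict \<phi> (verts F)"
    by (simp add: hom_fiber_def)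
  have fin: "finite (edges G)" "finite (edges F)"
    using F G finite_edges by blast+
  have r: "restrict i e = restrict \<phi> e" if "e \<in> edges F" for e
  proof -
    have "e \<subseteq> verts F"
      using F that by (auto simp: is_graph_def)
    then show ?thesis
      unfolding i by (simp add: Int_absorb1)
  qed
  show "\<pi> (Poly_Mapping.map int (hom_vector G \<phi>)) = Poly_Mapping.map int (hom_vector F i)"
  proof (rule poly_mapping_eqI)
    fix d :: "'v set \<times> ('v \<Rightarrow> 'w)"
    show "Poly_Mapping.lookup (\<pi> (Poly_Mapping.map int (hom_vector G \<phi>))) d =
        Poly_Mapping.lookup (Poly_Mapping.map int (hom_vector F i)) d"
      using sub by (cases d) (auto simp: lookup_\<pi> map.rep_eq when_def lookup_hom_vector fin r)
  qed
qed

section \<open>The fiber product and the ideal of the union\<close>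

theorem proposition5p1:
  fixes G1 G2 :: "'v graph" and H :: "'w graph"
  assumes "is_graph G1" and "is_graph G2" and "is_graph H"
    and "induced_subgraph (graph_inter G1 G2) G1"
    and "induced_subgraph (graph_inter G1 G2) G2"
  shows
    "toric_fiber_data (graph_hom (graph_inter G1 G2) H)
       (hom_fiber (graph_inter G1 G2) G1 H) (hom_fiber (graph_inter G1 G2) G2 H)
       (hom_vector (graph_inter G1 G2)) (\<lambda>i. hom_vector G1) (\<lambda>i. hom_vector G2) \<and>
     mpoly_rename (hom_glue G1) `
       toric_fiber_product (graph_hom (graph_inter G1 G2) H)
         (hom_fiber (graph_inter G1 G2) G1 H) (hom_fiber (graph_inter G1 G2) G2 H)
         (\<lambda>i. hom_vector G1) (\<lambda>i. hom_vector G2)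
     = (hom_ideal (graph_union G1 G2) H :: ('v \<Rightarrow> 'w, 'k::field) mpoly set)"
proof
  let ?F = "graph_inter G1 G2" and ?U = "graph_union G1 G2"
  let ?T = "toric_fiber_index (graph_hom ?F H) (hom_fiber ?F G1 H) (hom_fiber ?F G2 H)"
  let ?v = "\<lambda>(i :: 'v \<Rightarrow> 'w, j, k). vec_pair (hom_vector G1 j) (hom_vector G2 k)"
  have fin: "finite (edges G1)" "finite (edges G2)" "finite (edges ?U)"
    using assms(1,2) finite_edges by (auto simp: graph_union_def)
  have sub1: "e \<subseteq> verts G1" if "e \<in> edges G1" for e
    using assms(1) that by (auto simp: is_graph_def)
  have sub2: "e \<subseteq> verts G2" if "e \<in> edges G2" for e
    using assms(2) that by (auto simp: is_graph_def)
  have F: "is_graph ?F"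
    unfolding is_graph_def
  proof (intro conjI ballI)
    show "finite (verts ?F)"
      using assms(1) by (simp add: is_graph_def graph_inter_def)
    fix e assume "e \<in> edges ?F"
    then have e: "e \<in> edges G1" "e \<subseteq> verts G1" "e \<subseteq> verts G2"
      using sub1 sub2 by (auto simp: graph_inter_def)
    obtain u v where "e = {u, v}"
      using assms(1) e(1) unfolding is_graph_def by blast
    then show "\<exists>u \<in> verts ?F. \<exists>v \<in> verts ?F. e = {u, v}"
      using e(2,3) by (auto simp: graph_inter_def)
  qed
  have subF: "edges ?F \<subseteq> edges G1" "edges ?F \<subseteq> edges G2"
    by (auto simp: graph_inter_def)
  have U: "is_graph ?U"
    using assms(1,2) unfolding is_graph_def graph_union_def by fastforce
  have finJ: "finite (hom_fiber ?F G1 H i)" "finite (hom_fiber ?F G2 H i)" for i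
    using finite_graph_hom[OF assms(1,3)] finite_graph_hom[OF assms(2,3)]
    by (auto simp: hom_fiber_def)
  show "toric_fiber_data (graph_hom ?F H) (hom_fiber ?F G1 H) (hom_fiber ?F G2 H)
      (hom_vector ?F) (\<lambda>i. hom_vector G1) (\<lambda>i. hom_vector G2)"
    unfolding toric_fiber_data_def
    using finite_graph_hom[OF F assms(3)] finJ
      hom_vector_projection[OF F assms(1) subF(1), of H] hom_vector_projection[OF F assms(2) subF(2), of H]
    by blast

  have bij: "bij_betw (hom_glue G1) ?T (graph_hom ?U H)"
    by (rule hom_glue_bij(1)[OF assms(1,2)])
  \<comment> \<open>Since \<open>e\<close> lies in \<open>verts G1\<close>, restricting to
    \<open>e\<close> factors through the restriction to \<open>verts G1\<close>, which recovers
    \<open>j\<close> from the glued map.\<close>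
  have restr: "restrict (hom_glue G1 (i, j, k)) e = restrict j e" if "(i, j, k) \<in> ?T" "e \<in> edges G1" for i j k e
    using hom_glue_bij(2)[OF assms(1,2) that(1)] sub1[OF that(2)]
    by (metis inf.absorb_iff2 restrict_restrict)
  have restr': "restrict (hom_glue G1 (i, j, k)) e = restrict k e" if "(i, j, k) \<in> ?T" "e \<in> edges G2" for i j k e
    using hom_glue_bij(2)[OF assms(1,2) that(1)] sub2[OF that(2)]
    by (metis inf.absorb_iff2 restrict_restrict)
  \<comment> \<open>The left block of the pair is zero at edges outside \<open>G1\<close>, while the
    vector of the union may be nonzero there; hence the conditional.\<close>
  have Inl: "Poly_Mapping.lookup (?v t) (Inl (e, \<psi>)) =
      (if e \<in> edges G1 then Poly_Mapping.lookup (hom_vector ?U (hom_glue G1 t)) (e, \<psi>) else 0)"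
    if "t \<in> ?T" for t e \<psi>
    using that restr
    by (cases t) (auto simp: lookup_vec_pair lookup_hom_vector fin graph_union_def)
  have Inr: "Poly_Mapping.lookup (?v t) (Inr (e, \<psi>)) =
      (if e \<in> edges G2 then Poly_Mapping.lookup (hom_vector ?U (hom_glue G1 t)) (e, \<psi>) else 0)"
    if "t \<in> ?T" for t e \<psi>
    using that restr'
    by (cases t) (auto simp: lookup_vec_pair lookup_hom_vector fin graph_union_def)
  have out: "Poly_Mapping.lookup (hom_vector ?U \<phi>) (e, \<psi>) = 0"
    if "e \<notin> edges G1" "e \<notin> edges G2" for \<phi> e \<psi>
    using that by (simp add: lookup_hom_vector fin(3)) (simp add: graph_union_def)

  have "mpoly_rename (hom_glue G1) ` toric_ideal ?T ?v \<subseteq>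
      (toric_ideal (graph_hom ?U H) (hom_vector ?U) :: ('v \<Rightarrow> 'w, 'k) mpoly set)"
  proof (rule mpoly_rename_toric_ideal_subset)
    show "hom_glue G1 t \<in> graph_hom ?U H" if "t \<in> ?T" for t
      using bij that by (auto simp: bij_betw_def)
    fix d :: "'v set \<times> ('v \<Rightarrow> 'w)"
    obtain e \<psi> where d: "d = (e, \<psi>)" by (cases d)
    \<comment> \<open>The first two cases overlap in the common edges, for which either block of the
      pair provides the coordinate. In the third case \<open>e\<close> is no edge of the union at
      all.\<close>
    consider "e \<in> edges G1" | "e \<in> edges G2" | "e \<notin> edges G1" "e \<notin> edges G2" by blast
    then show "(\<exists>d'. \<forall>t \<in> ?T. Poly_Mapping.lookup (hom_vector ?U (hom_glue G1 t)) d = Poly_Mapping.lookup (?v t) d') \<or>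
        (\<forall>t \<in> ?T. Poly_Mapping.lookup (hom_vector ?U (hom_glue G1 t)) d = 0)"
    proof cases
      case 1
      then show ?thesis unfolding d using Inl[of _ e \<psi>] by (intro disjI1 exI[of _ "Inl (e, \<psi>)"]) simp
    next
      case 2
      then show ?thesis unfolding d using Inr[of _ e \<psi>] by (intro disjI1 exI[of _ "Inr (e, \<psi>)"]) simp
    next
      case 3
      then show ?thesis unfolding d using out by blast
    qed
  qed
  moreover have "(toric_ideal (graph_hom ?U H) (hom_vector ?U) :: ('v \<Rightarrow> 'w, 'k) mpoly set) \<subseteq>
      mpoly_rename (hom_glue G1) ` toric_ideal ?T ?v"
  proof
    fix p :: "('v \<Rightarrow> 'w, 'k) mpoly"
    assume p: "p \<in> toric_ideal (graph_hom ?U H) (hom_vector ?U)"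
    \<comment> \<open>Renaming along the inverse of gluing carries \<open>p\<close> into the ideal
      of the fiber product, and the result is the preimage sought for \<open>p\<close>.\<close>
    let ?g = "inv_into ?T (hom_glue G1)"
    have g: "?g \<phi> \<in> ?T" "hom_glue G1 (?g \<phi>) = \<phi>" if "\<phi> \<in> graph_hom ?U H" for \<phi>
      using bij that by (auto simp: bij_betw_def intro: inv_into_into f_inv_into_f)
    have "mpoly_rename ?g ` toric_ideal (graph_hom ?U H) (hom_vector ?U) \<subseteq>
        (toric_ideal ?T ?v :: (_, 'k) mpoly set)"
    proof (rule mpoly_rename_toric_ideal_subset[OF g(1)])
      fix d :: "'v set \<times> ('v \<Rightarrow> 'w) + 'v set \<times> ('v \<Rightarrow> 'w)"
      show "(\<exists>d'. \<forall>\<phi> \<in> graph_hom ?U H. Poly_Mapping.lookup (?v (?g \<phi>)) d = Poly_Mapping.lookup (hom_vector ?U \<phi>) d') \<or>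
          (\<forall>\<phi> \<in> graph_hom ?U H. Poly_Mapping.lookup (?v (?g \<phi>)) d = 0)"
      proof (cases d)
        case d: (Inl x)
        obtain e \<psi> where x: "x = (e, \<psi>)" by (cases x)
        show ?thesis
          \<comment> \<open>Since gluing undoes \<open>?g\<close>, the entry at
            \<open>Inl (e, \<psi>)\<close> is that of \<phi> at \<open>(e, \<psi>)\<close> for an
            edge of \<open>G1\<close>, and 0 otherwise. The right block leads to the same coordinate
            for an edge of \<open>G2\<close>.\<close>
          unfolding d x using Inl[OF g(1), of _ e \<psi>] g(2)
          by (cases "e \<in> edges G1") (auto intro!: exI[of _ "(e, \<psi>)"])
      next
        case d: (Inr x)
        obtain e \<psi> where x: "x = (e, \<psi>)" by (cases x)
        show ?thesis
          unfolding d x using Inr[OF g(1), of _ e \<psi>] g(2)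
          by (cases "e \<in> edges G2") (auto intro!: exI[of _ "(e, \<psi>)"])
      qed
    qed
    then have q: "mpoly_rename ?g p \<in> toric_ideal ?T ?v"
      using p by blast
    have "mpoly_rename (hom_glue G1) (mpoly_rename ?g p) = p"
      using g(2) toric_ideal_carrier p by (intro mpoly_rename_inverse[of "graph_hom ?U H"]) blast+
    then show "p \<in> mpoly_rename (hom_glue G1) ` toric_ideal ?T ?v"
      by (rule image_eqI[OF sym q])
  qed
  \<comment> \<open>The inclusions concern toric ideals; as the union is a graph, its toric ideal is
    the kernel that defines \<open>hom_ideal\<close>.\<close>
  ultimately show "mpoly_rename (hom_glue G1) `
      toric_fiber_product (graph_hom ?F H) (hom_fiber ?F G1 H) (hom_fiber ?F G2 H)
        (\<lambda>i. hom_vector G1) (\<lambda>i. hom_vector G2)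
    = (hom_ideal ?U H :: ('v \<Rightarrow> 'w, 'k) mpoly set)"
    unfolding toric_fiber_product_def hom_ideal_eq_toric_ideal[OF U] by blast
qed

end
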